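(* For integers $n\ge 2$, $$\mathrm{Cond}(V_{\Phi_n})=O\left(n^{\,n^{\frac{1}{\log\log n}}+\frac{\log n}{\log\log n}+3}\; e^{\,n^{\frac{1}{\log\log n}}}\right),$$ where the implied constant is independent of $n$.
   Context: For $n\ge 2$, $\Phi_n$ is the $n$-th cyclotomic polynomial, $m=\phi(n)$ its degree ($\phi$ is Euler's totient), and $\zeta_1,\dots,\zeta_m\in\mathbb{C}$ are the primitive $n$-th roots of unity (in any fixed order). $V_{\Phi_n}$ is the $m\times m$ Vandermonde matrix whose $(i,j)$ entry is $\zeta_i^{\,j-1}$, $1\le i,j\le m$. For a complex matrix $A=(a_{ij})$, $\|A\|=\sqrt{\sum_{i,j}|a_{ij}|^2}$ is the Frobenius norm, and for invertible $A$, $\mathrm{Cond}(A)=\|A\|\,\|A^{-1}\|$. $\log$ is the natural logarithm. *)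

theory Defs
  imports
    Complex_Main
    "HOL-Number_Theory.Totient"
    "Jordan_Normal_Form.Gauss_Jordan_Elimination"
    "Jordan_Normal_Form.Determinant"
begin

definition primitive_roots :: "nat \<Rightarrow> complex set" where
  "primitive_roots n = {z. z ^ n = 1 \<and> (\<forall>k. 0 < k \<and> k < n \<longrightarrow> z ^ k \<noteq> 1)}"

(* The nodes are zeta 1, ..., zeta m; matrix indices start at 0, so the entry written
   zeta_i ^ (j - 1) with 1 <= i, j <= m sits at position (i - 1, j - 1). *)
definition vandermonde_mat :: "nat \<Rightarrow> (nat \<Rightarrow> complex) \<Rightarrow> complex mat" where
  "vandermonde_mat m \<zeta> = mat m m (\<lambda>(i, j). \<zeta> (i + 1) ^ j)"

definition frobenius_norm :: "complex mat \<Rightarrow> real" where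
  "frobenius_norm A = sqrt (\<Sum>i<dim_row A. \<Sum>j<dim_col A. (cmod (A $$ (i, j)))\<^sup>2)"

(* Meaningful for invertible A only; see mat_inverse_vandermonde_mat below. *)
definition cond_number :: "complex mat \<Rightarrow> real" where
  "cond_number A = frobenius_norm A * frobenius_norm (the (mat_inverse A))"

text \<open>The following two facts show that enumerations of the primitive roots by
  \<open>{1..totient n}\<close> exist, and that their Vandermonde matrices are invertible.\<close>

lemma card_primitive_roots:
  assumes "n > 0"
  shows "finite (primitive_roots n)" "card (primitive_roots n) = totient n"
proof -
  define f where "f = (\<lambda>k::nat. cis (2 * pi * real k / real n))"
  have pw: "f k ^ j = cis (2 * pi * real (k * j) / real n)" for k j
    by (simp add: f_def DeMoivre mult_ac)
  have one: "cis (2 * pi * real a / real n) = 1 \<longleftrightarrow> n dvd a" for a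
  proof
    assume "cis (2 * pi * real a / real n) = 1"
    then have "cos (2 * pi * real a / real n) = 1"
      by (simp add: complex_eq_iff)
    then obtain x :: int where "2 * pi * real a / real n = of_int x * 2 * pi"
      by (auto simp: cos_one_2pi_int)
    then have "real a = of_int x * real n"
      using assms by (simp add: field_simps)
    then have "int a = x * int n"
      by (metis of_int_eq_iff of_int_mult of_int_of_nat_eq)
    then show "n dvd a"
      by (metis dvd_triv_right int_dvd_int_iff)
  next
    assume "n dvd a"
    then obtain b where "a = n * b" by blast
    then show "cis (2 * pi * real a / real n) = 1"
      using assms cis_multiple_2pi[of "real b"] by (simp add: mult_ac)
  qed
  have bij: "bij_betw f {..<n} {z. z ^ n = 1}"
    using bij_betw_roots_unity[OF assms] by (simp add: f_def)
  have prim: "f k \<in> primitive_roots n \<longleftrightarrow> coprime k n" for k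
  proof -
    have "f k \<in> primitive_roots n \<longleftrightarrow> (\<forall>j. 0 < j \<and> j < n \<longrightarrow> \<not> n dvd k * j)"
      unfolding primitive_roots_def mem_Collect_eq pw one by simp
    also have "\<dots> \<longleftrightarrow> coprime k n"
    proof
      assume c: "coprime k n"
      then show "\<forall>j. 0 < j \<and> j < n \<longrightarrow> \<not> n dvd k * j"
        by (metis coprime_commute coprime_dvd_mult_right_iff nat_dvd_not_less)
    next
      assume *: "\<forall>j. 0 < j \<and> j < n \<longrightarrow> \<not> n dvd k * j"
      show "coprime k n"
      proof (rule ccontr)
        assume nc: "\<not> coprime k n"
        define d where "d = gcd k n"
        have d: "d dvd k" "d dvd n" "d \<noteq> 1" "d > 0"
          using nc assms by (auto simp: d_def coprime_iff_gcd_eq_1)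
        obtain u v where u: "k = d * u" and v: "n = d * v"
          using d by blast
        have "0 < v" "v < n"
          using v assms d by auto
        moreover have "n dvd k * v"
          by (simp add: u v)
        ultimately show False using * by blast
      qed
    qed
    finally show ?thesis .
  qed
  have eq: "primitive_roots n = f ` {k. k < n \<and> coprime k n}"
  proof (intro equalityI subsetI)
    fix z assume z: "z \<in> primitive_roots n"
    then have "z \<in> f ` {..<n}"
      using bij by (auto simp: bij_betw_def primitive_roots_def)
    with z prim show "z \<in> f ` {k. k < n \<and> coprime k n}" by auto
  qed (use prim in auto)
  then show "finite (primitive_roots n)" by simp
  have inj: "inj_on f {k. k < n \<and> coprime k n}"
    using bij by (auto simp: bij_betw_def inj_on_def)
  have "card (primitive_roots n) = card {k. k < n \<and> coprime k n}"
    by (simp add: eq card_image[OF inj])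
  also have "\<dots> = totient n"
  proof (cases "n = 1")
    case True
    then have "{k. k < n \<and> coprime k n} = {0}" by auto
    then show ?thesis using True by simp
  next
    case False
    have "{k. k < n \<and> coprime k n} = totatives n"
    proof (rule Set.set_eqI)
      fix k
      show "k \<in> {k. k < n \<and> coprime k n} \<longleftrightarrow> k \<in> totatives n"
        using False assms
        by (cases "k = 0"; cases "k = n") (auto simp: totatives_def)
    qed
    then show ?thesis by (simp add: totient_def)
  qed
  finally show "card (primitive_roots n) = totient n" .
qed

lemma mat_inverse_vandermonde_mat:
  assumes inj: "inj_on \<zeta> {1..m}"
  shows "mat_inverse (vandermonde_mat m \<zeta>) \<noteq> None"
proof
  let ?V = "vandermonde_mat m \<zeta>"
  have V: "?V \<in> carrier_mat m m"
    by (simp add: vandermonde_mat_def)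
  assume "mat_inverse ?V = None"
  then have "?V \<notin> Units (ring_mat TYPE(complex) m ())"
    by (rule mat_inverse(1)[OF V])
  then have "det ?V = 0"
    using det_non_zero_imp_unit[OF V, of "()"] by blast
  then obtain v where v: "v \<in> carrier_vec m" "v \<noteq> 0\<^sub>v m" "?V *\<^sub>v v = 0\<^sub>v m"
    using det_0_iff_vec_prod_zero_field[OF V] by blast
  define p where "p = (\<Sum>j<m. monom (v $ j) j)"
  have cf: "coeff p j = (if j < m then v $ j else 0)" for j
    by (simp add: p_def coeff_sum sum.delta)
  have "p \<noteq> 0"
  proof
    assume "p = 0"
    then have "v $ j = 0" if "j < m" for j
      using cf[of j] that by simp
    then have "v = 0\<^sub>v m"
      using v(1) by (intro eq_vecI) auto
    with v(2) show False by simp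
  qed
  have m: "m > 0"
    using v by (cases m) auto
  have "poly p (\<zeta> i) = 0" if i: "i \<in> {1..m}" for i
  proof -
    have "(?V *\<^sub>v v) $ (i - 1) = (\<Sum>j<m. \<zeta> i ^ j * v $ j)"
      using i v(1) by (auto simp: vandermonde_mat_def scalar_prod_def atLeast0LessThan)
    moreover have "(?V *\<^sub>v v) $ (i - 1) = 0"
      using i v(3) by auto
    ultimately show ?thesis
      by (simp add: p_def poly_sum poly_monom mult.commute)
  qed
  then have "card (\<zeta> ` {1..m}) \<le> card {x. poly p x = 0}"
    by (intro card_mono) (auto simp: poly_roots_finite[OF \<open>p \<noteq> 0\<close>])
  also have "\<dots> \<le> degree p"
    using card_poly_roots_bound[OF \<open>p \<noteq> 0\<close>] by simp
  also have "degree p < m"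
    using m by (intro le_less_trans[OF degree_le[of "m - 1"]]) (auto simp: cf)
  finally show False
    using card_image[OF inj] by simp
qed

end

theory Submission
  imports
    Defs
    "HOL-Computational_Algebra.Polynomial_FPS"
    "HOL-Real_Asymp.Real_Asymp"
begin

text \<open>
  The columns of \<open>V\<^sup>-\<^sup>1\<close> are the coefficient vectors of the Lagrange basis polynomials
  \<open>L\<^sub>\<zeta> = F\<^sub>\<zeta> / F\<^sub>\<zeta>(\<zeta>)\<close>, where \<open>F\<^sub>\<zeta>(x)\<close> is the product of \<open>1 - x/\<eta>\<close> over the primitive
  roots \<open>\<eta> \<noteq> \<zeta>\<close>. Removing the roots of non-maximal order one prime at a time writes
  \<open>F(x) = (1 - x/\<zeta>) F\<^sub>\<zeta>(x)\<close> as a product of \<open>2\<^sup>\<omega>\<close> power series of the form \<open>1 - x\<^sup>d\<close> or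
  \<open>1 / (1 - x\<^sup>d)\<close>, where \<open>\<omega>\<close> is the number of prime divisors of \<open>n\<close>. The sum of the absolute values
  of the coefficients up to degree \<open>n\<close> is submultiplicative and at most \<open>n + 1\<close> for each factor,
  which bounds both \<open>F\<close> and \<open>1/F\<close> by \<open>(n + 1)\<^bsup>2^\<omega>\<^esup>\<close>. The first bound controls the coefficients of
  \<open>F\<^sub>\<zeta>\<close>; the second one controls \<open>\<Psi> = (1 - x\<^sup>n) / F\<close> and hence \<open>1/F\<^sub>\<zeta>(\<zeta>)\<close>, since
  \<open>F\<^sub>\<zeta>(\<zeta>) \<Psi>(\<zeta>) = n\<close>. So the condition number is at most \<open>(n + 1)\<^bsup>2 \<cdot> 2^\<omega> + 4\<^esup>\<close>. Finally
  \<open>\<omega>! \<le> n\<close> gives \<open>\<omega> \<le> (1 + o(1)) log n / log log n\<close>, and as \<open>2 < e\<close> the exponent is eventually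
  below \<open>n\<^bsup>1 / log log n\<^esup> = exp (log n / log log n)\<close>.
\<close>

section \<open>Truncated coefficient sums of power series\<close>

text \<open>The cut at degree \<open>n\<close> keeps the sum finite for
  \<open>1 / (1 - x^d)\<close>, which has infinitely many coefficients of norm 1.\<close>

definition fps_l1 :: "nat \<Rightarrow> 'a::real_normed_field fps \<Rightarrow> real" where
  "fps_l1 n f = (\<Sum>k\<le>n. norm (fps_nth f k))"

lemma fps_l1_nonneg: "fps_l1 n f \<ge> 0"
  by (simp add: fps_l1_def sum_nonneg)

lemma norm_fps_nth_le_l1: "k \<le> n \<Longrightarrow> norm (fps_nth f k) \<le> fps_l1 n f"
  unfolding fps_l1_def by (rule member_le_sum) auto

text \<open>A product coefficient of index at most \<open>n\<close> only involves pairs with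
  \<open>i + j \<le> n\<close>, and this triangle lies inside the square
  \<open>{..n} \<times> {..n}\<close>. So truncation preserves submultiplicativity.\<close>

lemma fps_l1_mult: "fps_l1 n (f * g) \<le> fps_l1 n f * fps_l1 n g"
proof -
  have "fps_l1 n (f * g) \<le> (\<Sum>k\<le>n. \<Sum>i\<le>k. norm (fps_nth f i) * norm (fps_nth g (k - i)))"
    unfolding fps_l1_def fps_mult_nth atLeast0AtMost
    by (intro sum_mono order.trans[OF norm_sum]) (simp add: norm_mult)
  also have "\<dots> = (\<Sum>(i,j)\<in>{(i,j). i + j \<le> n}. norm (fps_nth f i) * norm (fps_nth g j))"
    by (rule sum.triangle_reindex_eq [symmetric])
  also have "\<dots> \<le> (\<Sum>(i,j)\<in>{..n} \<times> {..n}. norm (fps_nth f i) * norm (fps_nth g j))"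
    by (rule sum_mono2) auto
  also have "\<dots> = fps_l1 n f * fps_l1 n g"
    by (simp add: fps_l1_def sum_product sum.cartesian_product)
  finally show ?thesis .
qed

lemma norm_poly_le_l1:
  fixes p :: "'a::real_normed_field poly"
  assumes "degree p \<le> n" "norm x = 1"
  shows "norm (poly p x) \<le> fps_l1 n (fps_of_poly p)"
proof -
  have "poly p x = (\<Sum>i\<le>n. coeff p i * x ^ i)"
    unfolding poly_altdef using assms(1)
    by (intro sum.mono_neutral_left) (auto simp: coeff_eq_0)
  then have "norm (poly p x) \<le> (\<Sum>i\<le>n. norm (coeff p i * x ^ i))"
    by (simp add: norm_sum)
  then show ?thesis
    using assms(2) by (simp add: norm_mult norm_power fps_l1_def)
qed

lemma fps_l1_one_minus:
  fixes c :: "'a::real_normed_field"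
  assumes "norm c = 1"
  shows "fps_l1 n (1 - fps_const c * fps_X ^ d) \<le> 2"
proof -
  have "fps_l1 n (1 - fps_const c * fps_X ^ d) \<le>
      (\<Sum>k\<le>n. (if k = 0 then 1 else 0) + (if k = d then 1 else 0))"
    unfolding fps_l1_def
    by (intro sum_mono order.trans[OF norm_triangle_ineq4])
       (auto simp: assms fps_X_power_iff intro!: order.trans[OF norm_triangle_ineq4])
  also have "\<dots> \<le> 2"
    by (simp add: sum.distrib)
  finally show ?thesis .
qed

lemma inverse_one_minus_fps_X_power:
  fixes c :: "'a::field"
  assumes "d > 0"
  shows "inverse (1 - fps_const c * fps_X ^ d) = Abs_fps (\<lambda>k. if d dvd k then c ^ (k div d) else 0)"
    (is "_ = ?g")
proof (rule fps_inverse_unique, rule fps_ext)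
  fix k
  have "fps_nth ((1 - fps_const c * fps_X ^ d) * ?g) k =
      fps_nth ?g k - c * (if k < d then 0 else fps_nth ?g (k - d))"
    by (simp add: algebra_simps fps_X_power_mult_nth mult.assoc)
  also have "\<dots> = (if k = 0 then 1 else 0)"
  proof (cases "k < d")
    case True
    then show ?thesis by (auto dest: dvd_imp_le)
  next
    case False
    then obtain j where "k = d + j" using nat_le_iff_add by (auto simp: not_less)
    then show ?thesis using assms by auto
  qed
  finally show "fps_nth ((1 - fps_const c * fps_X ^ d) * ?g) k = fps_nth 1 k"
    by simp
qed

text \<open>The geometric series has coefficients of norm 0 or 1. It serves \<open>1 - x^d\<close>
  with \<open>c = 1\<close> and a single factor \<open>1 - x/z\<close> with \<open>d = 1\<close>,
  \<open>c = 1/z\<close>.\<close>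

lemma fps_l1_inverse_one_minus:
  fixes c :: "'a::real_normed_field"
  assumes "d > 0" "norm c = 1"
  shows "fps_l1 n (inverse (1 - fps_const c * fps_X ^ d)) \<le> real n + 1"
proof -
  have "fps_l1 n (inverse (1 - fps_const c * fps_X ^ d)) \<le> (\<Sum>k\<le>n. 1)"
    unfolding fps_l1_def inverse_one_minus_fps_X_power[OF assms(1)]
    by (intro sum_mono) (auto simp: norm_power assms)
  then show ?thesis by simp
qed

section \<open>Polynomials with prescribed roots\<close>

text \<open>Normalised to constant coefficient 1, so that it is invertible as a power series.\<close>

definition root_poly :: "complex set \<Rightarrow> complex poly" where
  "root_poly W = (\<Prod>z\<in>W. [:1, - inverse z:])"

lemma coeff_0_root_poly: "coeff (root_poly W) 0 = 1"
  by (induction W rule: infinite_finite_induct) (auto simp: root_poly_def coeff_mult)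

lemma poly_root_poly: "poly (root_poly W) x = (\<Prod>z\<in>W. 1 - x / z)"
  by (simp add: root_poly_def poly_prod divide_inverse)

lemma degree_root_poly: "degree (root_poly W) \<le> card W"
proof (induction W rule: infinite_finite_induct)
  case (insert z W)
  then have "degree (root_poly (insert z W)) \<le> degree [:1, - inverse z:] + degree (root_poly W)"
    unfolding root_poly_def prod.insert[OF insert(1,2)] by (intro degree_mult_le)
  also have "\<dots> \<le> 1 + card W"
    using insert by (intro add_mono) auto
  finally show ?case using insert by simp
qed (auto simp: root_poly_def)

lemma root_poly_diff:
  assumes "finite W" "W' \<subseteq> W"
  shows "root_poly W = root_poly (W - W') * root_poly W'"
  unfolding root_poly_def using assms by (rule prod.subset_diff[rotated])

lemma fps_root_poly_diff:
  assumes "finite W" "W' \<subseteq> W"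
  shows "fps_of_poly (root_poly (W - W')) =
      fps_of_poly (root_poly W) * inverse (fps_of_poly (root_poly W'))"
proof -
  have "fps_of_poly (root_poly W) = fps_of_poly (root_poly (W - W')) * fps_of_poly (root_poly W')"
    by (simp add: root_poly_diff[OF assms] fps_of_poly_mult)
  moreover have "fps_of_poly (root_poly W') * inverse (fps_of_poly (root_poly W')) = 1"
    by (intro inverse_mult_eq_1') (simp add: coeff_0_root_poly)
  ultimately show ?thesis by (simp only: mult.assoc mult_1_right)
qed

lemma root_poly_singleton: "fps_of_poly (root_poly {z}) = 1 - fps_const (inverse z) * fps_X ^ 1"
  by (simp add: root_poly_def fps_of_poly_pCons fps_const_neg[symmetric] del: fps_const_neg)

text \<open>Both sides have degree at most \<open>d\<close> and agree at \<open>d + 1\<close>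
  points: the \<open>d\<close> roots of unity and 0, where the normalisation makes both equal to
  1.\<close>

lemma root_poly_unity:
  assumes "d > 0"
  shows "root_poly {z. z ^ d = 1} = 1 - monom 1 d"
proof (rule poly_eqI_degree)
  let ?U = "{z::complex. z ^ d = 1}"
  have fin: "finite ?U" using assms by (simp add: finite_roots_unity)
  have card: "card (insert 0 ?U) = d + 1"
    using assms fin by (simp add: card_insert_disjoint card_roots_unity_eq zero_power)
  show "degree (root_poly ?U) < card (insert 0 ?U)"
    using degree_root_poly[of ?U] assms by (simp add: card card_roots_unity_eq)
  have "degree (1 - monom 1 d :: complex poly) \<le> d"
    by (intro degree_diff_le) (auto simp: degree_monom_le)
  then show "degree (1 - monom 1 d :: complex poly) < card (insert 0 ?U)"
    by (simp add: card)
  show "poly (root_poly ?U) x = poly (1 - monom 1 d) x" if "x \<in> insert 0 ?U" for x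
  proof (cases "x = 0")
    case False
    with that have "x ^ d = 1" by simp
    then show ?thesis
      using False fin by (auto simp: poly_root_poly poly_monom intro!: bexI[of _ x])
  qed (use assms in \<open>auto simp: poly_root_poly poly_monom zero_power\<close>)
qed

lemma fps_root_poly_unity:
  assumes "d > 0"
  shows "fps_of_poly (root_poly {z. z ^ d = 1}) = 1 - fps_const 1 * fps_X ^ d"
  by (simp add: root_poly_unity[OF assms] fps_of_poly_monom)

section \<open>Sieving roots of unity by primes\<close>

text \<open>Interpolates between all \<open>d\<close>-th roots of unity (\<open>P\<close> empty) and
  the primitive ones (\<open>P\<close> the prime factors of \<open>d\<close>), so that induction on
  \<open>P\<close> is possible.\<close>

definition unity_roots_avoiding :: "nat \<Rightarrow> nat set \<Rightarrow> complex set" where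
  "unity_roots_avoiding d P = {z. z ^ d = 1 \<and> (\<forall>p\<in>P. z ^ (d div p) \<noteq> 1)}"

lemma power_gcd_eq_1:
  fixes z :: complex
  assumes "z ^ a = 1" "z ^ b = 1"
  shows "z ^ gcd a b = 1"
proof (cases "a = 0")
  case False
  then obtain x y where "a * x = b * y + gcd a b"
    using bezout_nat by blast
  then have "z ^ (a * x) = z ^ (b * y) * z ^ gcd a b"
    by (simp add: power_add)
  then show ?thesis by (simp add: power_mult assms)
qed (use assms in auto)

text \<open>The gcd of \<open>d/p\<close> and \<open>d/q\<close> is \<open>d/(pq)\<close>, so being
  a root of unity for both exponents is the same as being one for \<open>d/(pq)\<close>.\<close>

lemma power_div_prime_eq_1_iff:
  fixes z :: complex
  assumes "prime p" "prime q" "p \<noteq> q" "p dvd d" "q dvd d" "z ^ (d div p) = 1"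
  shows "z ^ (d div q) = 1 \<longleftrightarrow> z ^ (d div p div q) = 1"
proof -
  have "coprime p q" using assms primes_coprime by blast
  then have "p * q dvd d" using assms by (simp add: divides_mult)
  then obtain e where e: "d = p * q * e" by blast
  have pq: "p > 0" "q > 0" using assms prime_gt_0_nat by auto
  have dp: "d div p = q * e" and dq: "d div q = p * e" and dpq: "d div p div q = e"
    using pq by (simp_all add: e mult_ac)
  have "gcd (p * e) (q * e) = e"
    using \<open>coprime p q\<close> by (metis coprime_imp_gcd_eq_1 gcd_mult_distrib_nat mult.commute mult.right_neutral)
  then show ?thesis
    using power_gcd_eq_1[of z "p * e" "q * e"] assms(6) pq
    unfolding dp dq dpq by (auto simp: power_mult mult.commute[of p])
qed

text \<open>The new prime removes the roots with \<open>z^(d/p) = 1\<close>; for these, avoiding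
  \<open>P\<close> relative to \<open>d\<close> and relative to \<open>d/p\<close> are equivalent
  conditions.\<close>

lemma unity_roots_avoiding_insert:
  assumes "prime p" "p \<notin> P" "p dvd d" "\<And>q. q \<in> P \<Longrightarrow> prime q \<and> q dvd d"
  shows "unity_roots_avoiding (d div p) P \<subseteq> unity_roots_avoiding d P"
    "unity_roots_avoiding d (insert p P) =
      unity_roots_avoiding d P - unity_roots_avoiding (d div p) P"
proof -
  have "z ^ d = 1" if "z ^ (d div p) = 1" for z :: complex
    using that assms(3) by (metis dvd_mult_div_cancel mult.commute power_mult power_one)
  moreover have "z ^ (d div q) = 1 \<longleftrightarrow> z ^ (d div p div q) = 1"
    if "z ^ (d div p) = 1" "q \<in> P" for q and z :: complex
    using assms that by (intro power_div_prime_eq_1_iff) auto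
  ultimately show "unity_roots_avoiding (d div p) P \<subseteq> unity_roots_avoiding d P"
    "unity_roots_avoiding d (insert p P) =
      unity_roots_avoiding d P - unity_roots_avoiding (d div p) P"
    unfolding unity_roots_avoiding_def by auto
qed

text \<open>A new prime \<open>p\<close> gives the quotient of the series for \<open>d\<close> and
  \<open>d/p\<close>. Hence the two bounds must be proved together and for all \<open>d\<close>, and
  each prime squares the bound, which produces the exponent \<open>2 ^ card P\<close>.\<close>

lemma fps_l1_root_poly_avoiding:
  assumes "finite P" "\<And>p. p \<in> P \<Longrightarrow> prime p \<and> p dvd d" "0 < d" "0 < n"
  shows "fps_l1 n (fps_of_poly (root_poly (unity_roots_avoiding d P))) \<le> (real n + 1) ^ 2 ^ card P \<and>
    fps_l1 n (inverse (fps_of_poly (root_poly (unity_roots_avoiding d P)))) \<le> (real n + 1) ^ 2 ^ card P"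
  using assms(1,2,3)
proof (induction P arbitrary: d rule: finite_induct)
  case empty
  have "fps_l1 n (1 - fps_const (1::complex) * fps_X ^ d) \<le> real n + 1"
    using fps_l1_one_minus[of "1::complex" n d] assms(4) by simp
  moreover have "fps_l1 n (inverse (1 - fps_const (1::complex) * fps_X ^ d)) \<le> real n + 1"
    using empty by (intro fps_l1_inverse_one_minus) auto
  ultimately show ?case
    using empty by (simp add: unity_roots_avoiding_def fps_root_poly_unity del: fps_const_1_eq_1)
next
  case (insert p P)
  define F where "F e = fps_of_poly (root_poly (unity_roots_avoiding e P))" for e
  define K where "K = (real n + 1) ^ 2 ^ card P"
  have p: "prime p" "p dvd d" using insert by auto
  have dvd: "prime q \<and> q dvd d div p" if "q \<in> P" for q
  proof -
    have "coprime q p" using that insert by (metis insert_iff primes_coprime)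
    moreover have "q dvd d div p * p" using that insert p by simp
    ultimately show ?thesis using that insert coprime_dvd_mult_left_iff by blast
  qed
  have dp: "d div p > 0" using p insert by (simp add: div_greater_zero_iff dvd_imp_le prime_gt_0_nat)
  have 1: "fps_l1 n (F d) \<le> K" "fps_l1 n (inverse (F d)) \<le> K"
    using insert.IH[of d] insert.prems by (auto simp: F_def K_def)
  have 2: "fps_l1 n (F (d div p)) \<le> K" "fps_l1 n (inverse (F (d div p))) \<le> K"
    using insert.IH[of "d div p"] dvd dp by (auto simp: F_def K_def)
  have fin: "finite (unity_roots_avoiding d P)"
    using finite_roots_unity[of d, where 'a = complex] insert.prems
    by (auto simp: unity_roots_avoiding_def)
  have eq: "fps_of_poly (root_poly (unity_roots_avoiding d (insert p P))) = F d * inverse (F (d div p))"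
    unfolding F_def
    using unity_roots_avoiding_insert[of p P d] p insert
    by (simp add: fps_root_poly_diff[OF fin])
  have nz: "fps_nth (F e) 0 \<noteq> 0" for e
    by (simp add: F_def coeff_0_root_poly)
  have eq': "inverse (F d * inverse (F (d div p))) = inverse (F d) * F (d div p)"
    using nz by (simp add: fps_inverse_mult fps_inverse_idempotent)
  have K2: "K * K = (real n + 1) ^ 2 ^ card (insert p P)"
    using insert.hyps by (simp add: K_def power_add[symmetric] mult_2)
  have K: "K \<ge> 0" by (simp add: K_def)
  show ?case
    unfolding eq eq' K2[symmetric]
    using order.trans[OF fps_l1_mult mult_mono[OF 1(1) 2(2) K fps_l1_nonneg]]
      order.trans[OF fps_l1_mult mult_mono[OF 1(2) 2(1) K fps_l1_nonneg]] by blast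
qed

text \<open>If \<open>z^k = 1\<close> with \<open>0 < k < n\<close>, then \<open>z^g = 1\<close> for
  the proper divisor \<open>g = gcd k n\<close>; any prime \<open>p\<close> dividing
  \<open>n/g\<close> then satisfies \<open>z^(n/p) = 1\<close>.\<close>

lemma primitive_roots_eq_avoiding:
  assumes "n > 0"
  shows "primitive_roots n = unity_roots_avoiding n (prime_factors n)"
proof (intro equalityI subsetI)
  fix z assume z: "z \<in> unity_roots_avoiding n (prime_factors n)"
  have "z ^ k \<noteq> 1" if "0 < k" "k < n" for k
  proof
    assume "z ^ k = 1"
    define g where "g = gcd k n"
    have g: "z ^ g = 1" "g dvd n" "g < n"
      using z \<open>z ^ k = 1\<close> that le_less_trans[of g k n]
      by (auto simp: g_def unity_roots_avoiding_def power_gcd_eq_1 intro: gcd_le1_nat)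
    then obtain h where h: "n = g * h" by blast
    with g have "h \<noteq> 1" by auto
    then obtain p where p: "prime p" "p dvd h" using prime_factor_nat by blast
    then obtain l where l: "h = p * l" by blast
    have "n div p = g * l" using p prime_gt_0_nat[of p] by (simp add: h l)
    then have "z ^ (n div p) = 1" by (simp add: power_mult g)
    moreover have "p \<in> prime_factors n"
      using p assms h by (auto simp: prime_factors_dvd)
    ultimately show False using z by (auto simp: unity_roots_avoiding_def)
  qed
  with z show "z \<in> primitive_roots n"
    by (simp add: primitive_roots_def unity_roots_avoiding_def)
next
  fix z assume z: "z \<in> primitive_roots n"
  have "0 < n div p \<and> n div p < n" if "p \<in> prime_factors n" for p
    using that assms prime_gt_1_nat[of p]
    by (auto simp: prime_factors_dvd div_greater_zero_iff dvd_imp_le prime_gt_0_nat)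
  with z show "z \<in> unity_roots_avoiding n (prime_factors n)"
    by (auto simp: primitive_roots_def unity_roots_avoiding_def)
qed

section \<open>The inverse Vandermonde matrix and the condition number\<close>

text \<open>The two root sets partition the \<open>n\<close>-th roots of unity other than \<zeta>,
  so the product is the value at \<zeta> of \<open>(1 - x^n) / (1 - x/\<zeta>)\<close>.\<close>

lemma poly_root_poly_primitive:
  assumes "n > 0" "\<zeta> \<in> primitive_roots n"
  shows "poly (root_poly (primitive_roots n - {\<zeta>})) \<zeta> *
    poly (root_poly ({z. z ^ n = 1} - primitive_roots n)) \<zeta> = of_nat n"
proof -
  let ?U = "{z::complex. z ^ n = 1}" and ?W = "primitive_roots n"
  have W: "?W \<subseteq> ?U" by (auto simp: primitive_roots_def)
  have fin: "finite ?U" using assms by (simp add: finite_roots_unity)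
  have one: "\<zeta> ^ n = 1" using W assms by auto
  then have nz: "\<zeta> \<noteq> 0" using assms by (auto simp: zero_power)
  define A where "A = root_poly (?U - {\<zeta>})"
  have "A = root_poly (?U - {\<zeta>} - (?U - ?W)) * root_poly (?U - ?W)"
    unfolding A_def using fin assms by (intro root_poly_diff) auto
  moreover have "?U - {\<zeta>} - (?U - ?W) = ?W - {\<zeta>}" using W by auto
  ultimately have A: "A = root_poly (?W - {\<zeta>}) * root_poly (?U - ?W)" by simp
  have "1 - monom 1 n = A * [:1, - inverse \<zeta>:]"
    using root_poly_diff[of ?U "{\<zeta>}"] fin one assms
    by (simp add: A_def root_poly_unity) (simp add: root_poly_def)
  \<comment> \<open>Differentiating at the root \<open>\<zeta>\<close> extracts the value of the cofactor there.\<close>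
  then have "poly (pderiv (1 - monom 1 n)) \<zeta> = poly (pderiv (A * [:1, - inverse \<zeta>:])) \<zeta>"
    by simp
  then have "of_nat n * \<zeta> ^ (n - 1) = poly A \<zeta> * inverse \<zeta>"
    using nz by (simp add: pderiv_diff pderiv_monom poly_monom pderiv_mult pderiv_pCons algebra_simps
        del: mult_pCons_right)
  then have "of_nat n * (\<zeta> * \<zeta> ^ (n - 1)) = poly A \<zeta>"
    using nz by (simp add: field_simps)
  then show ?thesis
    using one assms(1) by (simp add: A power_eq_if)
qed

text \<open>Multiplying by the Vandermonde matrix evaluates a coefficient vector at the nodes, so
  Lagrange basis polynomials give a right inverse. A node 0 is excluded because
  \<open>1 - x / 0\<close> is 1 by convention and would not vanish there.\<close>

lemma mat_inverse_vandermonde_entry: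
  fixes \<zeta> :: "nat \<Rightarrow> complex"
  assumes inj: "inj_on \<zeta> {1..m}" and nz: "0 \<notin> \<zeta> ` {1..m}"
    and B: "mat_inverse (vandermonde_mat m \<zeta>) = Some B" and "i < m" "j < m"
  defines "R \<equiv> \<lambda>k. root_poly (\<zeta> ` {1..m} - {\<zeta> k})"
  shows "B $$ (j, i) = coeff (R (i + 1)) j / poly (R (i + 1)) (\<zeta> (i + 1))"
proof -
  let ?V = "vandermonde_mat m \<zeta>"
  let ?M = "mat m m (\<lambda>(j, i). coeff (R (i + 1)) j / poly (R (i + 1)) (\<zeta> (i + 1)))"
  have V: "?V \<in> carrier_mat m m" by (simp add: vandermonde_mat_def)
  have inv: "B * ?V = 1\<^sub>m m" "B \<in> carrier_mat m m"
    using mat_inverse(2)[OF V B] by auto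
  have "?V * ?M = 1\<^sub>m m"
  proof (rule eq_matI)
    fix i k assume "i < dim_row (1\<^sub>m m :: complex mat)" "k < dim_col (1\<^sub>m m :: complex mat)"
    then have i: "i < m" and k: "k < m" by auto
    have im: "\<zeta> (Suc i) \<in> \<zeta> ` {1..m}" "\<zeta> (Suc k) \<in> \<zeta> ` {1..m}" using i k by auto
    have "card (\<zeta> ` {1..m} - {\<zeta> (Suc k)}) = m - 1"
      using im card_image[OF inj] by (simp add: card_Diff_singleton)
    then have deg: "degree (R (Suc k)) < m"
      using degree_root_poly[of "\<zeta> ` {1..m} - {\<zeta> (Suc k)}"] k by (simp add: R_def)
    have "(?V * ?M) $$ (i, k) =
        (\<Sum>j<m. \<zeta> (Suc i) ^ j * (coeff (R (Suc k)) j / poly (R (Suc k)) (\<zeta> (Suc k))))"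
      using i k by (simp add: vandermonde_mat_def scalar_prod_def atLeast0LessThan)
    also have "\<dots> = (\<Sum>j<m. coeff (R (Suc k)) j * \<zeta> (Suc i) ^ j) / poly (R (Suc k)) (\<zeta> (Suc k))"
      by (simp add: sum_divide_distrib mult.commute)
    also have "(\<Sum>j<m. coeff (R (Suc k)) j * \<zeta> (Suc i) ^ j) = poly (R (Suc k)) (\<zeta> (Suc i))"
      unfolding poly_altdef using deg
      by (intro sum.mono_neutral_right) (auto simp: coeff_eq_0)
    also have "\<dots> / poly (R (Suc k)) (\<zeta> (Suc k)) = (if i = k then 1 else 0)"
    proof (cases "i = k")
      case True
      have "poly (R (Suc k)) (\<zeta> (Suc k)) \<noteq> 0"
        using nz by (auto simp: R_def poly_root_poly)
      then show ?thesis using True by simp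
    next
      case False
      then have "\<zeta> (Suc i) \<noteq> \<zeta> (Suc k)"
        using inj i k by (auto dest!: inj_onD)
      then have "poly (R (Suc k)) (\<zeta> (Suc i)) = 0"
        using im nz by (auto simp: R_def poly_root_poly intro!: bexI[of _ "\<zeta> (Suc i)"])
      then show ?thesis using False by simp
    qed
    finally show "(?V * ?M) $$ (i, k) = 1\<^sub>m m $$ (i, k)"
      using i k by simp
  qed (auto simp: vandermonde_mat_def)
  \<comment> \<open>\<open>B\<close> is a left inverse and \<open>?M\<close> a right inverse, so
    associativity identifies them.\<close>
  then have "B * (?V * ?M) = B" using inv by simp
  moreover have "B * (?V * ?M) = (B * ?V) * ?M"
    using inv V by (intro assoc_mult_mat[symmetric]) auto
  ultimately have "B = ?M" using inv by simp
  then show ?thesis using assms(4,5) by simp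
qed

lemma frobenius_norm_le:
  assumes "A \<in> carrier_mat m m" "c \<ge> 0"
    and "\<And>i j. i < m \<Longrightarrow> j < m \<Longrightarrow> cmod (A $$ (i, j)) \<le> c"
  shows "frobenius_norm A \<le> real m * c"
proof -
  have "(\<Sum>i<m. \<Sum>j<m. (cmod (A $$ (i, j)))\<^sup>2) \<le> (\<Sum>i<m. \<Sum>j<m. c\<^sup>2)"
    using assms by (intro sum_mono power_mono) auto
  also have "\<dots> = (real m * c)\<^sup>2" by (simp add: power2_eq_square)
  finally have "frobenius_norm A \<le> sqrt ((real m * c)\<^sup>2)"
    using assms unfolding frobenius_norm_def by (intro real_sqrt_le_mono) auto
  then show ?thesis using assms by simp
qed

lemma cond_number_vandermonde_le:
  assumes "n > 0" and bij: "bij_betw \<zeta> {1..totient n} (primitive_roots n)"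
  shows "cond_number (vandermonde_mat (totient n) \<zeta>) \<le>
    (real n + 1) ^ (2 * 2 ^ card (prime_factors n) + 4)"
proof -
  define m where "m = totient n"
  define W where "W = primitive_roots n"
  define U where "U = {z::complex. z ^ n = 1}"
  define N where "N = real n + 1"
  \<comment> \<open>The extra factor \<open>N\<close> pays for dividing by \<open>1 - x/z\<close> in
    the numerator and for multiplying by \<open>1 - x^n\<close> in the bound on the reciprocal of
    the denominator.\<close>
  define K where "K = N ^ (2 ^ card (prime_factors n) + 1)"
  let ?V = "vandermonde_mat m \<zeta>"
  have inj: "inj_on \<zeta> {1..m}" and img: "\<zeta> ` {1..m} = W"
    using bij by (auto simp: bij_betw_def m_def W_def)
  have fin: "finite U" and WU: "W \<subseteq> U"
    using assms by (auto simp: finite_roots_unity U_def W_def primitive_roots_def)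
  then have finW: "finite W" using finite_subset by blast
  have U: "cmod z = 1" if "z \<in> U" for z
    using that assms(1) power_eq_1_iff[of z n] by (simp add: U_def)
  have K: "K \<ge> 0" and N: "N \<ge> 0" by (simp_all add: K_def N_def)
  have mn: "real m \<le> N" unfolding m_def N_def using totient_le[of n] by linarith
  have FW: "fps_l1 n (fps_of_poly (root_poly W)) \<le> N ^ 2 ^ card (prime_factors n)"
    "fps_l1 n (inverse (fps_of_poly (root_poly W))) \<le> N ^ 2 ^ card (prime_factors n)"
    using fps_l1_root_poly_avoiding[of "prime_factors n" n n, OF finite_set_mset _ assms(1) assms(1)]
    unfolding W_def N_def primitive_roots_eq_avoiding[OF assms(1)]
    by (simp_all add: in_prime_factors_imp_prime in_prime_factors_imp_dvd)
  have ratio: "cmod (coeff (root_poly (W - {z})) j / poly (root_poly (W - {z})) z) \<le> K * K"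
    if z: "z \<in> W" and j: "j < m" for z j
  proof -
    have 1: "cmod z = 1" using z WU U by auto
    have "j \<le> n" using j mn by (simp add: m_def) (meson le_trans less_imp_le totient_le)
    then have "cmod (coeff (root_poly (W - {z})) j) \<le> fps_l1 n (fps_of_poly (root_poly (W - {z})))"
      using norm_fps_nth_le_l1[of j n "fps_of_poly (root_poly (W - {z}))"] by simp
    also have "\<dots> \<le> fps_l1 n (fps_of_poly (root_poly W)) * fps_l1 n (inverse (fps_of_poly (root_poly {z})))"
      using z finW by (subst fps_root_poly_diff) (auto intro: fps_l1_mult)
    also have "\<dots> \<le> N ^ 2 ^ card (prime_factors n) * N"
      unfolding root_poly_singleton
      using FW N fps_l1_inverse_one_minus[of 1 "inverse z" n] 1
      by (intro mult_mono) (simp_all add: N_def norm_inverse fps_l1_nonneg)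
    also have "\<dots> = K" by (simp add: K_def)
    finally have coeff: "cmod (coeff (root_poly (W - {z})) j) \<le> K" .
    \<comment> \<open>Truncation at \<open>n\<close> then loses no coefficient, so the coefficient
      sum bounds values on the unit circle.\<close>
    have "degree (root_poly (U - W)) \<le> n"
      using degree_root_poly[of "U - W"] card_mono[OF fin, of "U - W"] assms(1)
      by (simp add: U_def card_roots_unity_eq)
    then have "cmod (poly (root_poly (U - W)) z) \<le> fps_l1 n (fps_of_poly (root_poly (U - W)))"
      using 1 by (rule norm_poly_le_l1)
    also have "\<dots> \<le> fps_l1 n (fps_of_poly (root_poly U)) * fps_l1 n (inverse (fps_of_poly (root_poly W)))"
      using WU fin by (subst fps_root_poly_diff) (auto intro: fps_l1_mult)
    also have "\<dots> \<le> N * N ^ 2 ^ card (prime_factors n)"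
      unfolding U_def fps_root_poly_unity[OF assms(1)]
      using FW N assms(1) fps_l1_one_minus[of "1::complex" n n]
      by (intro mult_mono) (simp_all add: N_def fps_l1_nonneg)
    also have "\<dots> = K" by (simp add: K_def)
    finally have psi: "cmod (poly (root_poly (U - W)) z) \<le> K" .
    have eq: "poly (root_poly (W - {z})) z * poly (root_poly (U - W)) z = of_nat n"
      using poly_root_poly_primitive[OF assms(1)] z by (simp add: U_def W_def)
    then have "poly (root_poly (W - {z})) z \<noteq> 0" using assms(1) by auto
    with eq have "inverse (poly (root_poly (W - {z})) z) = poly (root_poly (U - W)) z / of_nat n"
      using assms(1) by (simp add: field_simps)
    then have "cmod (inverse (poly (root_poly (W - {z})) z)) = cmod (poly (root_poly (U - W)) z) / real n"
      by (simp add: norm_divide)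
    also have "\<dots> \<le> cmod (poly (root_poly (U - W)) z) / 1"
      using assms(1) by (intro divide_left_mono) auto
    finally show ?thesis
      unfolding divide_inverse norm_mult using coeff psi K by (intro mult_mono) auto
  qed
  obtain B where B: "mat_inverse ?V = Some B"
    using mat_inverse_vandermonde_mat[OF inj] by auto
  have V: "?V \<in> carrier_mat m m" by (simp add: vandermonde_mat_def)
  have "0 \<notin> W" using U WU by fastforce
  then have entry: "cmod (B $$ (j, i)) \<le> K * K" if "i < m" "j < m" for i j
    using ratio[of "\<zeta> (i + 1)" j] that mat_inverse_vandermonde_entry[OF inj _ B that] img by auto
  have "frobenius_norm B \<le> real m * (K * K)"
    using mat_inverse(2)[OF V B] entry K by (intro frobenius_norm_le) auto
  moreover have "frobenius_norm ?V \<le> real m * 1"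
  proof (rule frobenius_norm_le[OF V])
    fix i j assume "i < m" "j < m"
    then have "\<zeta> (Suc i) \<in> W" using img by auto
    then have "cmod (\<zeta> (Suc i)) = 1" using WU U by auto
    then show "cmod (?V $$ (i, j)) \<le> 1"
      using \<open>i < m\<close> \<open>j < m\<close> by (simp add: vandermonde_mat_def norm_power)
  qed simp
  ultimately have "cond_number ?V \<le> (real m * 1) * (real m * (K * K))"
    unfolding cond_number_def B option.sel
    by (intro mult_mono) (auto simp: frobenius_norm_def sum_nonneg)
  \<comment> \<open>Each Frobenius norm costs a factor \<open>m \<le> N\<close>; with
    \<open>K * K\<close> this gives the exponent \<open>2 * (2^\<omega> + 1) + 2\<close>.\<close>
  also have "\<dots> \<le> (N * 1) * (N * (K * K))"
    using mn K N by (intro mult_mono) auto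
  also have "\<dots> = N ^ Suc (Suc (2 ^ card (prime_factors n) + 1 + (2 ^ card (prime_factors n) + 1)))"
    by (simp only: K_def power_add power_Suc mult_1_right mult.assoc)
  also have "Suc (Suc (2 ^ card (prime_factors n) + 1 + (2 ^ card (prime_factors n) + 1))) =
      2 * 2 ^ card (prime_factors n) + 4"
    by simp
  finally show ?thesis by (simp add: m_def N_def)
qed

section \<open>The number of prime divisors\<close>

text \<open>The largest of \<open>k\<close> distinct positive integers is at least \<open>k\<close>;
  remove it and induct.\<close>

lemma fact_card_le_prod:
  fixes A :: "nat set"
  assumes "finite A" "\<And>a. a \<in> A \<Longrightarrow> a > 0"
  shows "fact (card A) \<le> \<Prod>A"
  using assms
proof (induction A rule: finite_linorder_max_induct)
  case (insert b A)
  have "insert b A \<subseteq> {1..b}" using insert by (auto simp: Suc_le_eq less_imp_le)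
  then have "card (insert b A) \<le> b" using card_mono[of "{1..b}"] by fastforce
  moreover have "b \<notin> A" using insert by auto
  moreover have "fact (card A) \<le> \<Prod>A" using insert by simp
  ultimately have "card (insert b A) * fact (card A) \<le> b * \<Prod>A" by (intro mult_le_mono)
  then show ?case using insert \<open>b \<notin> A\<close> by simp
qed simp

lemma fact_card_prime_factors_le:
  fixes n :: nat
  assumes "n > 0"
  shows "fact (card (prime_factors n)) \<le> n"
proof -
  have "fact (card (prime_factors n)) \<le> \<Prod>(prime_factors n)"
    by (rule fact_card_le_prod) (auto simp: prime_gt_0_nat in_prime_factors_imp_prime)
  also have "\<dots> \<le> (\<Prod>p\<in>prime_factors n. p ^ multiplicity p n)"
    by (intro prod_mono conjI self_le_power)
       (use assms in \<open>auto simp: prime_factors_multiplicity Suc_le_eq prime_gt_0_nat\<close>)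
  also have "\<dots> = n" using prime_factorization_nat[OF assms] by simp
  finally show ?thesis .
qed

text \<open>The term \<open>k^k / k!\<close> of the exponential series at \<open>k\<close> is at
  most \<open>exp k\<close>.\<close>

lemma ln_fact_ge:
  assumes "k > 0"
  shows "real k * (ln (real k) - 1) \<le> ln (fact k)"
proof -
  have "(\<Sum>i\<in>{k}. real k ^ i /\<^sub>R fact i) \<le> exp (real k)"
    unfolding exp_def by (intro sum_le_suminf summable_exp_generic) auto
  then have "real k ^ k \<le> fact k * exp (real k)" by (simp add: field_simps)
  then have "ln (real k ^ k) \<le> ln (fact k * exp (real k))"
    using assms by (subst ln_le_cancel_iff) auto
  then show ?thesis
    using assms by (simp add: ln_realpow ln_mult algebra_simps)
qed

text \<open>A bound strictly below 1 leaves room for the lower-order terms in the estimate of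
  \<omega>. It follows from \<open>2^6 < (5/2)^5\<close> and \<open>5/2 \<le> e\<close>.\<close>

lemma ln_2_le_5_6: "ln (2::real) \<le> 5/6"
proof -
  have "(2::real) ^ 6 \<le> (5/2) ^ 5" by (simp add: power_numeral_reduce)
  also have "\<dots> \<le> exp 1 ^ 5"
    using exp_lower_Taylor_quadratic[of 1] by (intro power_mono) auto
  also have "\<dots> = exp (5::real)" by (simp flip: exp_of_nat_mult)
  finally have "ln ((2::real) ^ 6) \<le> 5" by (metis ln_exp ln_le_cancel_iff exp_gt_zero zero_less_power zero_less_numeral)
  then show ?thesis by (subst (asm) ln_realpow) auto
qed

lemma eventually_card_prime_factors_bound:
  "eventually (\<lambda>n. 2 ^ (card (prime_factors n) + 4) \<le> exp (ln (real n) / ln (ln (real n)))) sequentially"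
proof -
  \<comment> \<open>\<open>h y\<close> solves \<open>y / ln y = (k + 4) * 5/6\<close> for
    \<open>k\<close>. As \<open>6/5 > 1\<close>, the quantity \<open>h y * (ln (h y) - 1)\<close>
    eventually exceeds \<open>y\<close>, which contradicts \<open>k! \<le> n\<close> when
    \<open>k \<ge> h y\<close>.\<close>
  define h where "h y = 6/5 * (y / ln y) - 4" for y :: real
  have "eventually (\<lambda>n. h (ln (real n)) \<ge> 3) sequentially"
    unfolding h_def by real_asymp
  moreover have "eventually (\<lambda>n. h (ln (real n)) * (ln (h (ln (real n))) - 1) > ln (real n)) sequentially"
    unfolding h_def by real_asymp
  ultimately show ?thesis
    using eventually_gt_at_top[of 0]
  proof eventually_elim
    case (elim n)
    define k where "k = card (prime_factors n)"
    define y where "y = ln (real n)"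
    show ?case
    proof (rule ccontr)
      assume "\<not> ?thesis"
      then have "exp (y / ln y) < 2 ^ (k + 4)" by (simp add: k_def y_def)
      then have "ln (exp (y / ln y)) < ln (2 ^ (k + 4))" by (subst ln_less_cancel_iff) auto
      then have "y / ln y < (real k + 4) * ln 2" by (simp add: ln_realpow)
      also have "\<dots> \<le> (real k + 4) * (5/6)"
        using ln_2_le_5_6 by (intro mult_left_mono) auto
      finally have "y / ln y < (real k + 4) * (5/6)" .
      moreover have "6/5 * q - 4 \<le> real k" if "q < (real k + 4) * (5/6)" for q
        using that by (simp add: field_simps)
      ultimately have hk: "h y \<le> real k" unfolding h_def by blast
      have h: "h y \<ge> 3" "y < h y * (ln (h y) - 1)" using elim by (simp_all add: y_def)
      \<comment> \<open>From \<open>h y \<ge> 3 \<ge> e\<close>; it makes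
        \<open>ln (h y) - 1\<close> nonnegative, as monotonicity of the product requires.\<close>
      have "ln (h y) \<ge> 1"
        using h(1) exp_le by (subst ln_ge_iff) auto
      then have "h y * (ln (h y) - 1) \<le> real k * (ln (real k) - 1)"
        using h(1) hk by (intro mult_mono) auto
      also have "\<dots> \<le> ln (fact k)" using hk h(1) by (intro ln_fact_ge) auto
      also have "\<dots> \<le> y"
      proof -
        have "fact k \<le> real n"
          using fact_card_prime_factors_le[OF elim(3)]
          by (metis k_def of_nat_fact of_nat_le_iff)
        then show ?thesis
          using elim(3) unfolding y_def by (subst ln_le_cancel_iff) auto
      qed
      finally show False using h(2) by simp
    qed
  qed
qed

section \<open>From the explicit bound to the asymptotic rate\<close>

theorem theorem5p4:
  shows "\<exists>C::real. \<forall>n::nat. \<forall>\<zeta>::nat \<Rightarrow> complex.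
    n \<ge> 2 \<longrightarrow> bij_betw \<zeta> {1..totient n} (primitive_roots n) \<longrightarrow>
    cond_number (vandermonde_mat (totient n) \<zeta>) \<le>
      C * (real n powr (real n powr (1 / ln (ln (real n))) + ln (real n) / ln (ln (real n)) + 3)
           * exp (real n powr (1 / ln (ln (real n)))))"
proof -
  define b :: "nat \<Rightarrow> real" where "b n = (real n + 1) ^ (2 * 2 ^ card (prime_factors n) + 4)" for n
  define r :: "nat \<Rightarrow> real" where "r n =
    real n powr (real n powr (1 / ln (ln (real n))) + ln (real n) / ln (ln (real n)) + 3)
      * exp (real n powr (1 / ln (ln (real n))))" for n
  obtain N where N: "\<And>n. n \<ge> N \<Longrightarrow>
      2 ^ (card (prime_factors n) + 4) \<le> exp (ln (real n) / ln (ln (real n)))"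
    using eventually_card_prime_factors_bound unfolding eventually_sequentially by blast
  have large: "b n \<le> r n" if n: "n \<ge> N" "n \<ge> 3" for n
  proof -
    define \<omega> where "\<omega> = card (prime_factors n)"
    define L where "L = ln (real n) / ln (ln (real n))"
    \<comment> \<open>Here \<open>n \<ge> 3\<close> matters: it makes \<open>ln (ln n)\<close>
      nonnegative, whereas it is negative for \<open>n = 2\<close>.\<close>
    have "ln (real n) \<ge> 1" using n(2) exp_le by (subst ln_ge_iff) auto
    then have L: "L \<ge> 0" by (simp add: L_def)
    have E: "real n powr (1 / ln (ln (real n))) = exp L"
      using n by (simp add: powr_def L_def)
    have "real n + 1 \<le> real n * real n"
    proof -
      have "real n * real n \<ge> real n * 3" using n by (intro mult_left_mono) auto
      then show ?thesis using n by linarith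
    qed
    then have "b n \<le> (real n ^ 2) ^ (2 * 2 ^ \<omega> + 4)"
      unfolding b_def \<omega>_def by (intro power_mono) (auto simp: power2_eq_square)
    \<comment> \<open>As \<open>2 ^ \<omega> \<ge> 1\<close>, the factor 8 absorbs the additive 4;
      with the square the exponent becomes \<open>16 * 2 ^ \<omega>\<close>, hence the shift
      \<open>\<omega> + 4\<close> in the eventual bound.\<close>
    also have "\<dots> \<le> (real n ^ 2) ^ (8 * 2 ^ \<omega>)"
    proof (rule power_increasing)
      have "(1::nat) \<le> 2 ^ \<omega>" by simp
      then show "(2 * 2 ^ \<omega> + 4 :: nat) \<le> 8 * 2 ^ \<omega>" by linarith
    qed (use n in simp)
    also have "\<dots> = real n ^ (2 ^ (\<omega> + 4))"
      by (simp flip: power_mult add: power_add mult.commute)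
    also have "\<dots> = real n powr (2 ^ (\<omega> + 4))"
      using n by (simp flip: powr_realpow)
    also have "\<dots> \<le> real n powr (exp L + L + 3)"
      using N[OF n(1)] L n by (intro powr_mono) (auto simp: \<omega>_def L_def)
    also have "\<dots> * 1 \<le> real n powr (exp L + L + 3) * exp (exp L)"
      by (intro mult_left_mono) auto
    also have "\<dots> = r n" unfolding r_def E L_def by simp
    finally show ?thesis by simp
  qed
  \<comment> \<open>The sum dominates each of the finitely many small ratios, and the 1 covers all
    large \<open>n\<close>.\<close>
  define C where "C = 1 + (\<Sum>n<max N 3. b n / r n)"
  have nonneg: "b n / r n \<ge> 0" for n by (simp add: b_def r_def)
  have "b n \<le> C * r n" if n: "n \<ge> 2" for n
  proof -
    have r: "r n > 0" using n by (simp add: r_def)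
    have "b n / r n \<le> C"
    proof (cases "n < max N 3")
      case True
      then have "b n / r n \<le> (\<Sum>n<max N 3. b n / r n)"
        using nonneg by (intro member_le_sum) auto
      then show ?thesis by (simp add: C_def)
    next
      case False
      then have "b n / r n \<le> 1" using large[of n] r by simp
      moreover have "(\<Sum>n<max N 3. b n / r n) \<ge> 0" using nonneg by (intro sum_nonneg) auto
      ultimately show ?thesis by (simp add: C_def)
    qed
    then show ?thesis using r by (simp add: field_simps)
  qed
  then have "cond_number (vandermonde_mat (totient n) \<zeta>) \<le> C * r n"
    if "n \<ge> 2" "bij_betw \<zeta> {1..totient n} (primitive_roots n)" for n \<zeta>
    using cond_number_vandermonde_le[of n \<zeta>] that unfolding b_def by fastforce
  then show ?thesis unfolding r_def by blast
qed

end
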